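(* Let $3 \leq d < n$ be integers. Among all trees on $n$ vertices with diameter $d$, the meeting time $T_{\mathsf{meet}}(G)$ is maximized uniquely (up to isomorphism) by the broom $B_{n,d}$, and $$T_{\mathsf{meet}}(B_{n,d}) = H(\pi, v_d) = 2(d-1) n + \frac{2d^3-6d^2+4d}{3(n-1)} -2 d^2+2 d+\frac{1}{2},$$ where $v_d$ is the endpoint of the handle of $B_{n,d}$ farthest from the bristles.
   Context: For a connected graph $G=(V,E)$, the simple random walk moves from its current vertex $u$ to a uniformly random neighbor of $u$. The hitting time $H(u,v)$ is the expected number of steps for the walk started at $u$ to reach $v$, with $H(u,u)=0$. The stationary distribution is $\pi_v = \deg(v)/2|E|$. The meeting time at $w$ is $H(\pi,w)=\sum_{v\in V}\pi_v H(v,w)$, and the meeting time of $G$ is $T_{\mathsf{meet}}(G)=\max_{w\in V} H(\pi,w)$. For $3\le d<n$, the broom $B_{n,d}$ is the tree on $n$ vertices consisting of a path $v_1,\ldots,v_d$ (the handle) together with $n-d$ leaves $u_1,\ldots,u_{n-d}$ (the bristles) all adjacent to $v_1$; it has diameter $d$. *)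

theory Defs
  imports "HOL-Probability.Probability" "Graph_Theory.Graph_Theory"
begin

text \<open>Finite simple graphs are those \<^typ>\<open>'a pair_pre_digraph\<close> satisfying \<^locale>\<open>pair_graph\<close>:
  every undirected edge is represented by its two opposite arcs.\<close>

definition neighbors :: "'a pair_pre_digraph \<Rightarrow> 'a \<Rightarrow> 'a set" where
  "neighbors G u = {v. (u, v) \<in> parcs G}"

definition edges :: "'a pair_pre_digraph \<Rightarrow> 'a set set" where
  "edges G = {{u, v} | u v. (u, v) \<in> parcs G}"

text \<open>The predicate \<open>Digraph_Component.tree\<close> is not applicable to symmetric digraphs, since it counts
  the walk \<open>a, b, a\<close> along one edge as a cycle; hence the length restriction.\<close>

definition is_tree :: "'a pair_pre_digraph \<Rightarrow> bool" where
  "is_tree G \<longleftrightarrow> pair_graph G \<and> Digraph_Component.connected (with_proj G)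
     \<and> \<not> (\<exists>p. pre_digraph.cycle (with_proj G) p \<and> 3 \<le> length p)"

definition graph_diameter :: "'a pair_pre_digraph \<Rightarrow> ereal" where
  "graph_diameter G = (SUP u\<in>pverts G. SUP v\<in>pverts G. wf_digraph.\<mu> (with_proj G) (\<lambda>_. 1) u v)"

text \<open>The walk is driven by i.i.d. random maps on the vertices: in each step every vertex
  independently selects a uniformly random neighbor, and the walk moves to the neighbor selected
  by its current vertex. See \<open>random_walk_law\<close> below for the resulting law.\<close>

definition step_space :: "'a pair_pre_digraph \<Rightarrow> ('a \<Rightarrow> 'a) measure" where
  "step_space G = (\<Pi>\<^sub>M u\<in>pverts G. uniform_count_measure (neighbors G u))"

definition walk_space :: "'a pair_pre_digraph \<Rightarrow> ('a \<Rightarrow> 'a) stream measure" where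
  "walk_space G = stream_space (step_space G)"

primrec random_walk :: "'a \<Rightarrow> ('a \<Rightarrow> 'a) stream \<Rightarrow> nat \<Rightarrow> 'a" where
  "random_walk u F 0 = u"
| "random_walk u F (Suc k) = (F !! k) (random_walk u F k)"

text \<open>The first time at which the trajectory \<open>X\<close> visits \<open>v\<close>; it is \<open>\<infinity>\<close> if there is none.\<close>

definition first_visit :: "'a \<Rightarrow> (nat \<Rightarrow> 'a) \<Rightarrow> ennreal" where
  "first_visit v X = (INF k\<in>{k. X k = v}. of_nat k)"

definition hitting_time :: "'a pair_pre_digraph \<Rightarrow> 'a \<Rightarrow> 'a \<Rightarrow> ennreal" where
  "hitting_time G u v = (\<integral>\<^sup>+ F. first_visit v (random_walk u F) \<partial>walk_space G)"

definition stationary :: "'a pair_pre_digraph \<Rightarrow> 'a \<Rightarrow> real" where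
  "stationary G v = real (card (neighbors G v)) / (2 * real (card (edges G)))"

definition meeting_time_at :: "'a pair_pre_digraph \<Rightarrow> 'a \<Rightarrow> ennreal" where
  "meeting_time_at G w = (\<Sum>v\<in>pverts G. ennreal (stationary G v) * hitting_time G v w)"

definition meeting_time :: "'a pair_pre_digraph \<Rightarrow> ennreal" where
  "meeting_time G = (MAX w\<in>pverts G. meeting_time_at G w)"

datatype broom_vertex = Handle nat | Bristle nat

definition broom_half_arcs :: "nat \<Rightarrow> nat \<Rightarrow> broom_vertex rel" where
  "broom_half_arcs n d = {(Handle i, Handle (Suc i)) | i. 1 \<le> i \<and> i < d}
     \<union> {(Handle 1, Bristle j) | j. 1 \<le> j \<and> j \<le> n - d}"

definition broom :: "nat \<Rightarrow> nat \<Rightarrow> broom_vertex pair_pre_digraph" where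
  "broom n d = \<lparr>pverts = Handle ` {1..d} \<union> Bristle ` {1..n - d},
                parcs = broom_half_arcs n d \<union> (broom_half_arcs n d)\<inverse>\<rparr>"

lemma random_walk_SCons: "random_walk u (f ## F) (Suc k) = random_walk (f u) F k"
  by (induction k) auto

context
  fixes G :: "'a pair_pre_digraph"
  assumes G: "pair_graph G" and no_isolated: "\<And>u. u \<in> pverts G \<Longrightarrow> neighbors G u \<noteq> {}"
begin

lemma neighbors_subset: "neighbors G u \<subseteq> pverts G"
proof -
  interpret pair_graph G by (rule G)
  show ?thesis by (auto simp: neighbors_def dest: in_arcsD2)
qed

lemma finite_pverts: "finite (pverts G)"
proof -
  interpret pair_graph G by (rule G)
  show ?thesis by (rule pair_finite_verts)
qed

lemma finite_neighbors: "finite (neighbors G u)"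
  using neighbors_subset finite_pverts by (rule finite_subset)

lemma prob_space_neighbors:
  "u \<in> pverts G \<Longrightarrow> prob_space (uniform_count_measure (neighbors G u))"
  by (intro prob_space_uniform_count_measure finite_neighbors no_isolated)

lemma prob_space_step_space: "prob_space (step_space G)"
  unfolding step_space_def by (intro prob_space_PiM prob_space_neighbors)

lemma space_step_space: "space (step_space G) = (\<Pi>\<^sub>E u\<in>pverts G. neighbors G u)"
  by (auto simp: step_space_def space_PiM space_uniform_count_measure)

lemma sets_step_space: "sets (step_space G) = Pow (space (step_space G))"
proof -
  have "sets (step_space G) = sets (\<Pi>\<^sub>M u\<in>pverts G. count_space (neighbors G u))"
    unfolding step_space_def
    by (intro sets_PiM_cong refl) (simp add: sets_uniform_count_measure)
  also have "\<dots> = sets (count_space (\<Pi>\<^sub>E u\<in>pverts G. neighbors G u))"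
    by (subst count_space_PiM_finite)
       (simp_all add: finite_pverts finite_neighbors countable_finite)
  finally show ?thesis by (simp add: space_step_space)
qed

lemma emeasure_step_space:
  assumes "u \<in> pverts G"
  shows "emeasure (step_space G) {f \<in> space (step_space G). f u = v}
    = (if (u, v) \<in> parcs G then ennreal (1 / card (neighbors G u)) else 0)"
proof -
  interpret P: prob_space "uniform_count_measure (neighbors G u)"
    using assms by (rule prob_space_neighbors)
  have "emeasure (step_space G) {f \<in> space (step_space G). f u = v}
    = emeasure (step_space G) ((\<lambda>f. f u) -` ({v} \<inter> neighbors G u) \<inter> space (step_space G))"
    using assms by (intro arg_cong[where f = "emeasure _"]) (auto simp: space_step_space)
  also have "\<dots> = emeasure (distr (step_space G) (uniform_count_measure (neighbors G u)) (\<lambda>f. f u))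
      ({v} \<inter> neighbors G u)"
    unfolding step_space_def using assms
    by (intro emeasure_distr[symmetric] measurable_component_singleton)
       (auto simp: sets_uniform_count_measure)
  also have "distr (step_space G) (uniform_count_measure (neighbors G u)) (\<lambda>f. f u)
      = uniform_count_measure (neighbors G u)"
    unfolding step_space_def using assms
    by (intro distr_PiM_component prob_space_neighbors)
  also have "emeasure \<dots> ({v} \<inter> neighbors G u)
      = (if (u, v) \<in> parcs G then ennreal (1 / card (neighbors G u)) else 0)"
    by (subst emeasure_uniform_count_measure) (use finite_neighbors[of u] in \<open>auto simp: neighbors_def\<close>)
  finally show ?thesis .
qed

lemma random_walk_in_pverts:
  assumes "u \<in> pverts G" "F \<in> space (walk_space G)"
  shows "random_walk u F k \<in> pverts G"
proof (induction k)
  case (Suc k)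
  have "F !! k \<in> space (step_space G)"
    using assms(2) by (auto simp: walk_space_def space_stream_space streams_iff_snth)
  then show ?case
    using Suc neighbors_subset by (fastforce simp: space_step_space)
qed (use assms in simp)

lemma measurable_random_walk:
  assumes "u \<in> pverts G"
  shows "(\<lambda>F. random_walk u F k) \<in> measurable (walk_space G) (count_space (pverts G))"
proof (induction k)
  case (Suc k)
  have "(\<lambda>f. f w) \<in> measurable (step_space G) (count_space (pverts G))" if "w \<in> pverts G" for w
    using that neighbors_subset
    by (fastforce simp: measurable_def sets_step_space space_step_space)
  then have "(\<lambda>F. (F !! k) w) \<in> measurable (walk_space G) (count_space (pverts G))"
    if "w \<in> pverts G" for w
    using that unfolding walk_space_def
    by (intro measurable_compose[OF measurable_snth]) auto
  then have "(\<lambda>F. (F !! k) (random_walk u F k)) \<in> measurable (walk_space G) (count_space (pverts G))"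
    by (rule measurable_compose_countable'[OF _ Suc countable_finite[OF finite_pverts]])
  then show ?case by simp
qed (use assms in simp)

theorem random_walk_law:
  assumes "u \<in> pverts G"
  shows "emeasure (walk_space G) {F \<in> space (walk_space G). \<forall>i\<le>k. random_walk u F i = p i}
    = (if p 0 = u then \<Prod>i<k. if (p i, p (Suc i)) \<in> parcs G
         then ennreal (1 / card (neighbors G (p i))) else 0 else 0)"
  using assms
proof (induction k arbitrary: u p)
  case 0
  interpret S: prob_space "walk_space G"
    unfolding walk_space_def by (rule prob_space.prob_space_stream_space[OF prob_space_step_space])
  show ?case by (simp add: S.emeasure_space_1)
next
  case (Suc k)
  interpret M: prob_space "step_space G" by (rule prob_space_step_space)
  let ?Q = "\<lambda>u p k F. \<forall>i\<le>k. random_walk u F i = p i"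
  let ?W = "walk_space G"
  let ?c = "\<Prod>i<k. if (p (Suc i), p (Suc (Suc i))) \<in> parcs G
         then ennreal (1 / card (neighbors G (p (Suc i)))) else 0"
  have shift: "?Q u p (Suc k) (f ## F) \<longleftrightarrow> u = p 0 \<and> ?Q (f u) (\<lambda>i. p (Suc i)) k F" for f F
    unfolding less_Suc_eq_le[symmetric] All_less_Suc2 random_walk_SCons by simp
  have "{F \<in> space ?W. random_walk u F i = p i} \<in> sets ?W" for i
  proof -
    have "{F \<in> space ?W. random_walk u F i = p i}
      = (\<lambda>F. random_walk u F i) -` ({p i} \<inter> pverts G) \<inter> space ?W"
      using random_walk_in_pverts[OF Suc.prems] by fastforce
    also have "\<dots> \<in> sets ?W"
      using measurable_random_walk[OF Suc.prems] by (rule measurable_sets) simp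
    finally show ?thesis .
  qed
  then have "{F \<in> space ?W. \<forall>i\<in>{..Suc k}. random_walk u F i = p i} \<in> sets ?W"
    by (intro sets.sets_Collect_finite_All) auto
  then have meas: "{F \<in> space ?W. ?Q u p (Suc k) F} \<in> sets ?W"
    by (simp only: Ball_def atMost_iff)
  have "emeasure ?W {F \<in> space ?W. ?Q u p (Suc k) F}
    = (\<integral>\<^sup>+ f. emeasure ?W {F \<in> space ?W. f ## F \<in> {F \<in> space ?W. ?Q u p (Suc k) F}} \<partial>step_space G)"
    using meas unfolding walk_space_def by (rule M.emeasure_stream_space)
  also have "\<dots> = (\<integral>\<^sup>+ f. (if p 0 = u then ?c else 0)
      * indicator {f \<in> space (step_space G). f u = p (Suc 0)} f \<partial>step_space G)"
  proof (rule nn_integral_cong)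
    fix f assume f: "f \<in> space (step_space G)"
    then have fu: "f u \<in> pverts G"
      using Suc.prems neighbors_subset by (fastforce simp: space_step_space)
    have "{F \<in> space ?W. f ## F \<in> {F \<in> space ?W. ?Q u p (Suc k) F}}
      = {F \<in> space ?W. u = p 0 \<and> ?Q (f u) (\<lambda>i. p (Suc i)) k F}"
      using f by (simp only: mem_Collect_eq shift) (auto simp: walk_space_def space_stream_space)
    then show "emeasure ?W {F \<in> space ?W. f ## F \<in> {F \<in> space ?W. ?Q u p (Suc k) F}}
      = (if p 0 = u then ?c else 0) * indicator {f \<in> space (step_space G). f u = p (Suc 0)} f"
      using f Suc.IH[OF fu, of "\<lambda>i. p (Suc i)"] by (auto simp: indicator_def)
  qed
  also have "\<dots> = (if p 0 = u then ?c else 0)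
      * emeasure (step_space G) {f \<in> space (step_space G). f u = p (Suc 0)}"
    by (rule nn_integral_cmult_indicator) (simp add: sets_step_space)
  also have "\<dots> = (if p 0 = u then \<Prod>i<Suc k. if (p i, p (Suc i)) \<in> parcs G
         then ennreal (1 / card (neighbors G (p i))) else 0 else 0)"
    unfolding emeasure_step_space[OF Suc.prems] prod.lessThan_Suc_shift
    by (auto simp: mult.commute)
  finally show ?case .
qed

end

end

theory Submission
  imports Defs
begin

text \<open>Root a tree at \<open>w\<close>, let \<open>h u\<close> be the hitting time of \<open>w\<close> from \<open>u\<close> and let \<open>D u\<close> be the
  increment of \<open>h\<close> from the parent of \<open>u\<close> to \<open>u\<close>. Summation by parts turns the degree-weighted sum
  of \<open>h\<close> into the Dirichlet energy of \<open>h\<close>, so \<open>H(\<pi>, w)\<close> is \<open>1 / (2 (n - 1))\<close> times the sum of all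
  \<open>(D u)\<^sup>2\<close>. The first-step equations yield \<open>D \<ge> 1\<close> and show that the increments on level \<open>k\<close> add up to
  \<open>2 N - m\<close>, where \<open>m\<close> vertices have depth \<open>k\<close> and \<open>N \<le> n - k\<close> vertices have depth at least \<open>k\<close>.
  Hence level \<open>k < d\<close> contributes at most \<open>(2 (n - k) - 1)\<^sup>2\<close>, with equality only if \<open>m = 1\<close>; on level
  \<open>d\<close>, the lowest possible, \<open>D = 1\<close>. Equality on all levels forces the broom rooted at the end of its
  handle.\<close>

section \<open>First-step analysis of the random walk\<close>

text \<open>Times without a visit count as \<open>\<top>\<close>, so the index set no longer depends
  on the trajectory. Measurability and the time shift in \<open>first_visit_SCons\<close> work on
  this form.\<close>

lemma first_visit_altdef: "first_visit v X = (INF k. if X k = v then of_nat k else \<top>)"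
  (is "_ = (INF k. ?a k)")
  unfolding first_visit_def
proof (intro antisym INF_greatest)
  show "(INF k\<in>{k. X k = v}. of_nat k) \<le> ?a k" for k
    by (cases "X k = v") (simp_all add: INF_lower)
  show "(INF k. ?a k) \<le> of_nat k" if "k \<in> {k. X k = v}" for k
    using that INF_lower[of k UNIV ?a] by simp
qed

lemma first_visit_start [simp]: "first_visit v (random_walk v F) = 0"
proof -
  have "first_visit v (random_walk v F) \<le> of_nat 0"
    unfolding first_visit_def by (rule INF_lower) simp
  then show ?thesis by simp
qed

text \<open>Index 0 contributes \<open>\<top>\<close>, so the infimum may start at 1; from there on
  the trajectory is the walk from \<open>f u\<close>, observed one time unit later.\<close>

lemma first_visit_SCons:
  assumes "u \<noteq> v"
  shows "first_visit v (random_walk u (f ## F)) = 1 + first_visit v (random_walk (f u) F)"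
proof -
  let ?a = "\<lambda>X k. if X k = v then of_nat k else \<top> :: ennreal"
  let ?X = "random_walk u (f ## F)"
  let ?Y = "random_walk (f u) F"
  have a0: "?a ?X 0 = \<top>"
    using assms by simp
  have a_Suc: "?a ?X (Suc k) = 1 + ?a ?Y k" for k
    by (simp add: random_walk_SCons del: random_walk.simps(2))
  have "first_visit v ?X = (INF k. ?a ?X k)"
    by (rule first_visit_altdef)
  also have "\<dots> = (INF k. ?a ?X (Suc k))"
  proof (rule antisym)
    show "(INF k. ?a ?X k) \<le> (INF k. ?a ?X (Suc k))"
      by (rule INF_greatest, rule INF_lower) simp
    show "(INF k. ?a ?X (Suc k)) \<le> (INF k. ?a ?X k)"
    proof (rule INF_greatest)
      show "(INF k. ?a ?X (Suc k)) \<le> ?a ?X k" for k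
      proof (cases k)
        case (Suc m)
        show ?thesis unfolding Suc by (rule INF_lower) simp
      qed (simp only: a0 top_greatest)
    qed
  qed
  also have "\<dots> = (INF k. 1 + ?a ?Y k)"
    by (simp only: a_Suc)
  also have "\<dots> = 1 + (INF k. ?a ?Y k)"
    by (rule INF_ennreal_const_add)
  also have "(INF k. ?a ?Y k) = first_visit v ?Y"
    by (rule first_visit_altdef[symmetric])
  finally show ?thesis .
qed

text \<open>Truncated times admit an induction on the truncation level; monotone convergence then
  recovers the full expectation.\<close>

lemma first_visit_eq_SUP: "first_visit v X = (SUP k. min (first_visit v X) (of_nat k))"
proof (rule antisym)
  show "(SUP k. min (first_visit v X) (of_nat k)) \<le> first_visit v X"
    by (rule SUP_least) simp
  show "first_visit v X \<le> (SUP k. min (first_visit v X) (of_nat k))"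
  proof (cases "first_visit v X = \<top>")
    case True
    then have "(SUP k. min (first_visit v X) (of_nat k)) = (SUP k. of_nat k)"
      by (simp only: min_top2 top_greatest min.absorb2)
    then show ?thesis
      by (simp only: ennreal_SUP_of_nat_eq_top top_greatest)
  next
    case False
    then obtain k where "first_visit v X < of_nat k"
      using ennreal_Ex_less_of_nat[of "first_visit v X"] less_top by blast
    then show ?thesis
      using SUP_upper[of k UNIV "\<lambda>k. min (first_visit v X) (of_nat k)"] by (simp add: min.absorb1)
  qed
qed

lemma hitting_time_same: "hitting_time G v v = 0"
  by (simp add: hitting_time_def)

context
  fixes G :: "'a pair_pre_digraph"
  assumes G: "pair_graph G" and no_isolated: "\<And>u. u \<in> pverts G \<Longrightarrow> neighbors G u \<noteq> {}"
begin

text \<open>The integrand sees only the coordinate at \<open>u\<close>, which is uniform on the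
  neighbors; splitting by its value gives an average.\<close>

lemma nn_integral_step_space:
  assumes "u \<in> pverts G"
  shows "(\<integral>\<^sup>+ f. \<phi> (f u) \<partial>step_space G)
    = (\<Sum>x\<in>neighbors G u. ennreal (1 / card (neighbors G u)) * \<phi> x)"
proof -
  have "(\<integral>\<^sup>+ f. \<phi> (f u) \<partial>step_space G)
    = (\<integral>\<^sup>+ f. (\<Sum>x\<in>neighbors G u. \<phi> x * indicator {f \<in> space (step_space G). f u = x} f) \<partial>step_space G)"
  proof (rule nn_integral_cong)
    fix f assume f: "f \<in> space (step_space G)"
    then have fu: "f u \<in> neighbors G u"
      using assms by (auto simp: space_step_space[OF G no_isolated])
    have "(\<Sum>x\<in>neighbors G u. \<phi> x * indicator {f \<in> space (step_space G). f u = x} f)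
      = (\<Sum>x\<in>neighbors G u. if f u = x then \<phi> x else 0)"
      using f by (intro sum.cong) (auto simp: indicator_def)
    then show "\<phi> (f u) = (\<Sum>x\<in>neighbors G u. \<phi> x * indicator {f \<in> space (step_space G). f u = x} f)"
      using fu finite_neighbors[OF G no_isolated, of u] by (simp add: sum.delta)
  qed
  also have "\<dots> = (\<Sum>x\<in>neighbors G u. \<integral>\<^sup>+ f. \<phi> x * indicator {f \<in> space (step_space G). f u = x} f \<partial>step_space G)"
    by (rule nn_integral_sum) (auto intro!: borel_measurable_times_ennreal borel_measurable_indicator simp: sets_step_space[OF G no_isolated])
  also have "\<dots> = (\<Sum>x\<in>neighbors G u. \<phi> x * emeasure (step_space G) {f \<in> space (step_space G). f u = x})"
    by (intro sum.cong refl nn_integral_cmult_indicator) (simp add: sets_step_space[OF G no_isolated])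
  also have "\<dots> = (\<Sum>x\<in>neighbors G u. ennreal (1 / card (neighbors G u)) * \<phi> x)"
    by (intro sum.cong refl)
       (simp add: emeasure_step_space[OF G no_isolated assms] mult.commute, simp add: neighbors_def)
  finally show ?thesis .
qed

lemma measurable_first_visit:
  assumes "u \<in> pverts G"
  shows "(\<lambda>F. first_visit v (random_walk u F)) \<in> borel_measurable (walk_space G)"
  unfolding first_visit_altdef
proof (intro borel_measurable_INF)
  fix k
  show "(\<lambda>F. if random_walk u F k = v then of_nat k else \<top> :: ennreal) \<in> borel_measurable (walk_space G)"
    by (rule measurable_compose[OF measurable_random_walk[OF G no_isolated assms],
          where g = "\<lambda>x. if x = v then of_nat k else \<top>"]) auto
qed auto

lemma nn_integral_walk_space:
  assumes "\<phi> \<in> borel_measurable (walk_space G)"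
  shows "(\<integral>\<^sup>+ F. \<phi> F \<partial>walk_space G) = (\<integral>\<^sup>+ f. \<integral>\<^sup>+ F. \<phi> (f ## F) \<partial>walk_space G \<partial>step_space G)"
  using prob_space.nn_integral_stream_space[OF prob_space_step_space[OF G no_isolated]] assms
  unfolding walk_space_def by blast

lemma emeasure_walk_space: "emeasure (walk_space G) (space (walk_space G)) = 1"
  unfolding walk_space_def
  by (intro prob_space.emeasure_space_1 prob_space.prob_space_stream_space
      prob_space_step_space[OF G no_isolated])

lemma step_in_pverts: "u \<in> pverts G \<Longrightarrow> f \<in> space (step_space G) \<Longrightarrow> f u \<in> pverts G"
  using neighbors_subset[OF G no_isolated] by (auto simp: space_step_space[OF G no_isolated])

text \<open>The first map of the stream is integrated out, and the rest of the stream drives a walk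
  from \<open>f u\<close>. The equation holds in \<open>ennreal\<close>, before finiteness is
  known.\<close>

lemma hitting_time_step:
  assumes u: "u \<in> pverts G" and "u \<noteq> v"
  shows "hitting_time G u v
    = 1 + (\<Sum>x\<in>neighbors G u. ennreal (1 / card (neighbors G u)) * hitting_time G x v)"
proof -
  interpret S: prob_space "step_space G" by (rule prob_space_step_space[OF G no_isolated])
  have "hitting_time G u v
    = (\<integral>\<^sup>+ f. \<integral>\<^sup>+ F. 1 + first_visit v (random_walk (f u) F) \<partial>walk_space G \<partial>step_space G)"
    unfolding hitting_time_def
    by (subst nn_integral_walk_space[OF measurable_first_visit[OF u]]) (simp add: first_visit_SCons assms)
  also have "\<dots> = (\<integral>\<^sup>+ f. 1 + hitting_time G (f u) v \<partial>step_space G)"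
    unfolding hitting_time_def
    using step_in_pverts[OF u]
    by (intro nn_integral_cong, subst nn_integral_add)
       (auto intro: measurable_first_visit simp: emeasure_walk_space)
  also have "\<dots> = 1 + (\<integral>\<^sup>+ f. hitting_time G (f u) v \<partial>step_space G)"
    by (subst nn_integral_add)
       (auto intro!: measurableI simp: sets_step_space[OF G no_isolated] S.emeasure_space_1)
  finally show ?thesis
    by (simp add: nn_integral_step_space[OF u, where \<phi> = "\<lambda>x. hitting_time G x v"])
qed

text \<open>A comparison principle, proved by induction on the truncation level. First-step
  equations alone can admit infinite solutions; a finite supersolution excludes infinite hitting
  times.\<close>

lemma hitting_time_le_supersolution:
  assumes u: "u \<in> pverts G"
    and super: "\<And>u. u \<in> pverts G \<Longrightarrow> u \<noteq> v
      \<Longrightarrow> 1 + (\<Sum>x\<in>neighbors G u. ennreal (1 / card (neighbors G u)) * g x) \<le> g u"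
  shows "hitting_time G u v \<le> g u"
proof -
  let ?t = "\<lambda>k u F. min (first_visit v (random_walk u F)) (of_nat k)"
  have meas: "?t k u \<in> borel_measurable (walk_space G)" if "u \<in> pverts G" for k u
    by (intro borel_measurable_min measurable_first_visit that) simp
  have trunc: "(\<integral>\<^sup>+ F. ?t k u F \<partial>walk_space G) \<le> g u" if "u \<in> pverts G" for k u
    using that
  proof (induction k arbitrary: u)
    case (Suc k)
    show ?case
    proof (cases "u = v")
      case False
      interpret S: prob_space "step_space G" by (rule prob_space_step_space[OF G no_isolated])
      \<comment> \<open>One step uses up one unit of truncation:
        \<open>min (1 + a) (1 + k) = 1 + min a k\<close>.\<close>
      have t_Suc: "?t (Suc k) u (f ## F) = 1 + ?t k (f u) F" for f F
        using False by (simp add: first_visit_SCons min_of_mono[where f = "(+) (1 :: ennreal)", symmetric] monoI add_left_mono)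
      have "(\<integral>\<^sup>+ F. ?t (Suc k) u F \<partial>walk_space G)
        = (\<integral>\<^sup>+ f. \<integral>\<^sup>+ F. 1 + ?t k (f u) F \<partial>walk_space G \<partial>step_space G)"
        by (subst nn_integral_walk_space[OF meas[OF Suc.prems]]) (simp only: t_Suc)
      also have "\<dots> = (\<integral>\<^sup>+ f. 1 + (\<integral>\<^sup>+ F. ?t k (f u) F \<partial>walk_space G) \<partial>step_space G)"
        using step_in_pverts[OF Suc.prems]
        by (intro nn_integral_cong, subst nn_integral_add) (auto intro!: meas simp: emeasure_walk_space)
      also have "\<dots> \<le> (\<integral>\<^sup>+ f. 1 + g (f u) \<partial>step_space G)"
        using step_in_pverts[OF Suc.prems] by (intro nn_integral_mono add_left_mono Suc.IH)
      also have "\<dots> = 1 + (\<integral>\<^sup>+ f. g (f u) \<partial>step_space G)"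
        by (subst nn_integral_add)
           (auto intro!: measurableI simp: sets_step_space[OF G no_isolated] S.emeasure_space_1)
      also have "\<dots> \<le> g u"
        using super[OF Suc.prems False] by (simp add: nn_integral_step_space[OF Suc.prems])
      finally show ?thesis .
    qed simp
  qed simp
  have "hitting_time G u v = (\<integral>\<^sup>+ F. (SUP k. ?t k u F) \<partial>walk_space G)"
    unfolding hitting_time_def by (intro nn_integral_cong first_visit_eq_SUP)
  also have "\<dots> = (SUP k. \<integral>\<^sup>+ F. ?t k u F \<partial>walk_space G)"
  proof (rule nn_integral_monotone_convergence_SUP)
    show "incseq (\<lambda>k. ?t k u)"
      by (intro incseq_SucI le_funI) (rule min.mono, auto)
  qed (rule meas[OF u])
  also have "\<dots> \<le> g u"
    by (intro SUP_least trunc u)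
  finally show ?thesis .
qed

end

section \<open>Rooted trees\<close>

text \<open>A tree given by parent pointers. Depth drops by one along each pointer, so iterating
  \<open>par\<close> reaches \<open>r\<close>; connectedness and the absence of long cycles follow.
  The form suits sums over levels and induction on depth.\<close>

locale rooted_tree =
  fixes G :: "'a pair_pre_digraph" and r :: 'a and par :: "'a \<Rightarrow> 'a" and dep :: "'a \<Rightarrow> nat"
  assumes finite_V: "finite (pverts G)"
    and root_in_V: "r \<in> pverts G"
    and dep_root: "dep r = 0"
    and par_in_V: "u \<in> pverts G - {r} \<Longrightarrow> par u \<in> pverts G"
    and dep_par: "u \<in> pverts G - {r} \<Longrightarrow> dep u = Suc (dep (par u))"
    and parcs_eq: "parcs G = (\<lambda>u. (u, par u)) ` (pverts G - {r}) \<union> (\<lambda>u. (par u, u)) ` (pverts G - {r})"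
begin

abbreviation "V \<equiv> pverts G"

definition chd :: "'a \<Rightarrow> 'a set" where
  "chd u = {v \<in> V - {r}. par v = u}"

definition lev :: "nat \<Rightarrow> 'a set" where
  "lev k = {u \<in> V. dep u = k}"

definition deep :: "nat \<Rightarrow> 'a set" where
  "deep k = {u \<in> V. k \<le> dep u}"

lemma arc_iff: "(u, v) \<in> parcs G \<longleftrightarrow> (u \<in> V - {r} \<and> v = par u) \<or> (v \<in> V - {r} \<and> u = par v)"
  unfolding parcs_eq by auto

lemma arc_dep: "(u, v) \<in> parcs G \<Longrightarrow> dep u = Suc (dep v) \<or> dep v = Suc (dep u)"
  using dep_par by (auto simp: arc_iff)

lemma par_neq: "u \<in> V - {r} \<Longrightarrow> par u \<noteq> u"
  using dep_par[of u] by auto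

lemma finite_arcs: "finite (parcs G)"
  unfolding parcs_eq using finite_V by auto

lemma pair_graph: "pair_graph G"
proof
  show "fst e \<in> V" "snd e \<in> V" if "e \<in> parcs G" for e
    using that by (auto simp: parcs_eq intro: par_in_V)
  show "fst e \<noteq> snd e" if "e \<in> parcs G" for e
    using that par_neq by (fastforce simp: parcs_eq)
  show "symmetric (with_proj G)"
    by (auto simp: symmetric_def sym_def arc_iff)
qed (auto simp: finite_V finite_arcs)

lemma finite_chd [simp]: "finite (chd u)"
  and finite_lev [simp]: "finite (lev k)"
  and finite_deep [simp]: "finite (deep k)"
  using finite_V by (auto simp: chd_def lev_def deep_def)

lemma neighbors_root: "neighbors G r = chd r"
  by (auto simp: neighbors_def arc_iff chd_def)

lemma neighbors_eq: "u \<in> V - {r} \<Longrightarrow> neighbors G u = insert (par u) (chd u)"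
  using par_in_V by (auto simp: neighbors_def arc_iff chd_def)

lemma par_notin_chd: "u \<in> V - {r} \<Longrightarrow> par u \<notin> chd u"
  using dep_par[of u] dep_par[of "par u"] by (auto simp: chd_def)

lemma card_neighbors: "u \<in> V - {r} \<Longrightarrow> card (neighbors G u) = Suc (card (chd u))"
  by (simp add: neighbors_eq par_notin_chd)

lemma dep_eq_0_iff: "u \<in> V \<Longrightarrow> dep u = 0 \<longleftrightarrow> u = r"
  using dep_par[of u] dep_root by (cases "u = r") auto

text \<open>Every non-root vertex owns the edge to its parent; depth tells which end of an edge is
  the child, so no edge is owned twice.\<close>

lemma card_edges: "card (edges G) = card V - 1"
proof -
  have "edges G = (\<lambda>u. {u, par u}) ` (V - {r})"
    unfolding edges_def by (auto simp: arc_iff)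
  moreover have "inj_on (\<lambda>u. {u, par u}) (V - {r})"
  proof (rule inj_onI)
    fix u v assume "u \<in> V - {r}" "v \<in> V - {r}" "{u, par u} = {v, par v}"
    then show "u = v"
      using dep_par[of u] dep_par[of v] by (auto simp: doubleton_eq_iff)
  qed
  ultimately show ?thesis
    using finite_V root_in_V by (simp add: card_image card_Diff_subset)
qed

lemma lev_0: "lev 0 = {r}"
  using dep_eq_0_iff root_in_V by (auto simp: lev_def dep_root)

lemma lev_Suc_subset: "lev (Suc k) \<subseteq> V - {r}"
  by (auto simp: lev_def dep_root)

lemma par_lev: "u \<in> lev (Suc k) \<Longrightarrow> par u \<in> lev k"
  using lev_Suc_subset[of k] par_in_V[of u] dep_par[of u] by (auto simp: lev_def)

lemma chd_lev: "u \<in> lev k \<Longrightarrow> {v \<in> lev (Suc k). par v = u} = chd u"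
  using lev_Suc_subset[of k] dep_par by (fastforce simp: lev_def chd_def)

lemma sum_lev_Suc: "(\<Sum>v\<in>lev (Suc k). f v) = (\<Sum>u\<in>lev k. \<Sum>v\<in>chd u. f v)"
proof -
  have "(\<Sum>u\<in>lev k. \<Sum>v\<in>{v \<in> lev (Suc k). par v = u}. f v) = (\<Sum>v\<in>lev (Suc k). f v)"
    using par_lev by (intro sum.group) auto
  then show ?thesis
    by (simp add: chd_lev)
qed

lemma sum_nonroot: "(\<Sum>v\<in>V - {r}. f v) = (\<Sum>u\<in>V. \<Sum>v\<in>chd u. f v)"
  unfolding chd_def using finite_V par_in_V by (intro sum.group[symmetric]) auto

lemma lev_nonempty: "u \<in> lev k \<Longrightarrow> j \<le> k \<Longrightarrow> lev j \<noteq> {}"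
proof (induction k arbitrary: u)
  case (Suc k)
  then show ?case
    using par_lev[of u k] by (cases "j = Suc k") auto
qed auto

lemma deep_eq: "deep k = lev k \<union> deep (Suc k)" and lev_deep_disjoint: "lev k \<inter> deep (Suc k) = {}"
  by (auto simp: deep_def lev_def)

lemma card_deep: "card (deep k) = card (lev k) + card (deep (Suc k))"
  by (subst deep_eq) (rule card_Un_disjoint, simp_all add: lev_deep_disjoint)

text \<open>A vertex of depth \<open>k\<close> has an ancestor on each of the levels 0 to
  \<open>k - 1\<close>, so at least \<open>k\<close> vertices lie outside
  \<open>deep k\<close>.\<close>

lemma card_deep_le:
  assumes "lev k \<noteq> {}"
  shows "card (deep k) + k \<le> card V"
proof -
  have "j \<in> dep ` (V - deep k)" if "j < k" for j
    using lev_nonempty[of _ k j] assms that by (force simp: lev_def deep_def)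
  then have "card {..<k} \<le> card (dep ` (V - deep k))"
    using finite_V by (intro card_mono) auto
  also have "\<dots> \<le> card (V - deep k)"
    using finite_V by (intro card_image_le) auto
  also have "\<dots> = card V - card (deep k)"
    by (intro card_Diff_subset) (auto simp: deep_def finite_V)
  finally have "k \<le> card V - card (deep k)" by simp
  moreover have "card (deep k) \<le> card V"
    by (intro card_mono) (auto simp: deep_def finite_V)
  ultimately show ?thesis by simp
qed

lemma card_deep_eq:
  assumes "\<And>j. 1 \<le> j \<Longrightarrow> j < k \<Longrightarrow> card (lev j) = 1"
  shows "card (deep k) + k = card V"
  using assms
proof (induction k)
  case 0
  then show ?case by (simp add: deep_def)
next
  case (Suc k)
  have "card (lev k) = 1"
    using Suc.prems[of k] by (cases k) (auto simp: lev_0)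
  then show ?case
    using Suc card_deep[of k] by simp
qed

text \<open>Depth changes by exactly one along each arc.\<close>

lemma awalk_dep_le:
  assumes "pre_digraph.awalk (with_proj G) u p v"
  shows "dep u \<le> dep v + length p"
proof -
  interpret pair_graph G by (rule pair_graph)
  show ?thesis using assms
  proof (induction p arbitrary: u)
    case (Cons e p)
    then show ?case
      using arc_dep[of u "snd e"] by (cases e) (fastforce simp: awalk_Cons_iff)
  qed (simp add: awalk_Nil_iff)
qed

text \<open>On a cycle of length at least three, a vertex of maximal depth would have two distinct
  neighbors of smaller depth.\<close>

lemma no_long_cycle: "\<not> (\<exists>p. pre_digraph.cycle (with_proj G) p \<and> 3 \<le> length p)"
proof
  interpret pair_graph G by (rule pair_graph)
  assume "\<exists>p. pre_digraph.cycle (with_proj G) p \<and> 3 \<le> length p"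
  then obtain p u where p: "awalk u p u" "distinct (tl (awalk_verts u p))" and len: "3 \<le> length p"
    by (auto simp: cycle_def)
  define m where "m = length p"
  \<comment> \<open>The heads of the arcs enumerate the cycle once; the start vertex
    \<open>u\<close> appears as \<open>x (m - 1)\<close>, which is why the arc with index 0 leaves
    from there.\<close>
  define x where "x i = snd (p ! i)" for i
  have verts: "awalk_verts u p = u # map snd p"
    using p(1) len awalk_verts_conv'[of u p u] by (cases p) (auto simp: awalk_def)
  have inj: "x i = x j \<longleftrightarrow> i = j" if "i < m" "j < m" for i j
    using p(2) that unfolding verts m_def x_def by (simp add: distinct_conv_nth) (metis nth_map)
  have x_last: "x (m - 1) = u"
  proof -
    have "last (awalk_verts u p) = u" using p(1) by auto
    then show ?thesis using len unfolding verts x_def m_def by (auto simp: last_map last_conv_nth split: if_splits)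
  qed
  have arc: "(if i = 0 then x (m - 1) else x (i - 1), x i) \<in> parcs G" if "i < m" for i
  proof -
    have "p ! i \<in> parcs G"
      using p(1) that by (auto simp: awalk_def m_def)
    moreover have "fst (p ! i) = (u # map snd p) ! i"
    proof -
      have "map fst p @ [snd (last p)] = u # map snd p"
        using awalk_verts_conv[of u p] len verts by auto
      then have "(map fst p @ [snd (last p)]) ! i = (u # map snd p) ! i" by simp
      then show ?thesis using that by (simp add: nth_append m_def)
    qed
    ultimately show ?thesis
      using that x_last by (cases i) (auto simp: x_def m_def prod_eq_iff, metis prod.collapse)+
  qed
  have fin: "finite {..<m}" "{..<m} \<noteq> {}" using len unfolding m_def by (auto simp: lessThan_empty_iff)
  obtain i where i: "i < m" and max: "\<And>j. j < m \<Longrightarrow> dep (x j) \<le> dep (x i)"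
  proof -
    have "Max ((dep \<circ> x) ` {..<m}) \<in> (dep \<circ> x) ` {..<m}"
      using fin by (intro Max_in) auto
    then obtain i where "i < m" "dep (x i) = Max ((dep \<circ> x) ` {..<m})" by auto
    then show ?thesis using fin by (intro that[of i]) auto
  qed
  \<comment> \<open>\<open>a\<close> and \<open>b\<close> are the cyclic predecessor and successor
    of \<open>i\<close>; they differ because the length is at least three.\<close>
  define a where "a = (if i = 0 then m - 1 else i - 1)"
  define b where "b = (if i = m - 1 then 0 else i + 1)"
  have ab: "a < m" "b < m" "a \<noteq> b"
    using i len by (auto simp: a_def b_def m_def)
  have "(x a, x i) \<in> parcs G"
    using arc[OF i] by (auto simp: a_def)
  moreover have "(x i, x b) \<in> parcs G"
    using arc[OF ab(2)] i by (auto simp: b_def split: if_splits)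
  ultimately have "x a = par (x i)" "x b = par (x i)"
    using max[OF ab(1)] max[OF ab(2)] dep_par[of "x a"] dep_par[of "x b"] unfolding arc_iff by auto
  then show False
    using inj ab by metis
qed

end

section \<open>Increments of hitting times on a tree\<close>

text \<open>Separates the real algebra of the first-step equations, here multiplied by the degree,
  from probability. The instance is \<open>mean_hit\<close>.\<close>

locale tree_potential = rooted_tree +
  fixes h :: "'a \<Rightarrow> real"
  assumes h_root: "h r = 0"
    and h_step: "u \<in> pverts G - {r} \<Longrightarrow>
      card (neighbors G u) * h u = card (neighbors G u) + (\<Sum>x\<in>neighbors G u. h x)"
begin

definition inc :: "'a \<Rightarrow> real" where
  "inc u = h u - h (par u)"

text \<open>The first-step equation says that the differences \<open>h u - h x\<close> over the
  neighbors \<open>x\<close> add up to the degree of \<open>u\<close>; the parent contributes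
  \<open>inc u\<close>, and each child \<open>c\<close> contributes \<open>- inc c\<close>.\<close>

lemma inc_eq:
  assumes "u \<in> V - {r}"
  shows "inc u = 1 + card (chd u) + (\<Sum>c\<in>chd u. inc c)"
proof -
  have "(\<Sum>c\<in>chd u. inc c) = (\<Sum>c\<in>chd u. h c - h u)"
    by (intro sum.cong) (auto simp: inc_def chd_def)
  then have "(\<Sum>c\<in>chd u. inc c) = (\<Sum>c\<in>chd u. h c) - card (chd u) * h u"
    by (simp add: sum_subtractf)
  moreover have "(1 + card (chd u)) * h u = 1 + card (chd u) + (h (par u) + (\<Sum>c\<in>chd u. h c))"
    using h_step[OF assms] assms by (simp add: card_neighbors) (simp add: neighbors_eq par_notin_chd)
  ultimately show ?thesis
    by (simp add: inc_def algebra_simps)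
qed

text \<open>Induction from the deepest level towards the root: nonnegative increments at the
  children suffice in \<open>inc_eq\<close>.\<close>

lemma inc_ge_1: "u \<in> V - {r} \<Longrightarrow> 1 \<le> inc u"
proof (induction "Max (dep ` V) - dep u" arbitrary: u rule: less_induct)
  case less
  have "0 \<le> inc c" if "c \<in> chd u" for c
  proof -
    have c: "c \<in> V - {r}" "dep c = Suc (dep u)"
      using that dep_par by (auto simp: chd_def)
    moreover have "dep c \<le> Max (dep ` V)"
      using c(1) finite_V by (intro Max_ge) auto
    ultimately have "1 \<le> inc c"
      by (intro less.hyps) auto
    then show ?thesis by simp
  qed
  then have "0 \<le> (\<Sum>c\<in>chd u. inc c)"
    by (rule sum_nonneg)
  then show ?case
    by (simp add: inc_eq[OF less.prems])
qed

text \<open>The left-hand side is the inner product of \<open>h\<close> with its Laplacian, the right-hand side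
  the Dirichlet energy of \<open>h\<close>.\<close>

lemma sum_degree_mult_h: "(\<Sum>v\<in>V. card (neighbors G v) * h v) = (\<Sum>u\<in>V - {r}. (inc u)\<^sup>2)"
proof -
  have "(\<Sum>v\<in>V. card (neighbors G v) * h v) = (\<Sum>v\<in>V - {r}. card (neighbors G v) * h v)"
    using finite_V by (intro sum.mono_neutral_right) (auto simp: h_root)
  also have "\<dots> = (\<Sum>v\<in>V - {r}. h v * inc v - (\<Sum>c\<in>chd v. h (par c) * inc c))"
  proof (intro sum.cong refl)
    fix v assume v: "v \<in> V - {r}"
    have "(\<Sum>c\<in>chd v. h (par c) * inc c) = h v * (\<Sum>c\<in>chd v. inc c)"
      unfolding sum_distrib_left by (intro sum.cong) (auto simp: chd_def)
    then show "card (neighbors G v) * h v = h v * inc v - (\<Sum>c\<in>chd v. h (par c) * inc c)"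
      by (simp add: inc_eq[OF v] card_neighbors[OF v] algebra_simps)
  qed
  also have "\<dots> = (\<Sum>v\<in>V - {r}. h v * inc v) - (\<Sum>v\<in>V - {r}. \<Sum>c\<in>chd v. h (par c) * inc c)"
    by (rule sum_subtractf)
  \<comment> \<open>Since \<open>h r = 0\<close>, the root may be added to the outer sum; then every
    non-root vertex occurs exactly once as a child.\<close>
  also have "(\<Sum>v\<in>V - {r}. \<Sum>c\<in>chd v. h (par c) * inc c) = (\<Sum>v\<in>V. \<Sum>c\<in>chd v. h (par c) * inc c)"
    using finite_V by (intro sum.mono_neutral_left) (auto simp: chd_def h_root)
  also have "\<dots> = (\<Sum>c\<in>V - {r}. h (par c) * inc c)"
    by (rule sum_nonroot[symmetric])
  also have "(\<Sum>v\<in>V - {r}. h v * inc v) - \<dots> = (\<Sum>u\<in>V - {r}. (inc u)\<^sup>2)"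
    unfolding sum_subtractf[symmetric]
    by (intro sum.cong) (auto simp: inc_def power2_eq_square algebra_simps)
  finally show ?thesis .
qed

lemma sum_inc_lev_step:
  "(\<Sum>u\<in>lev (Suc k). inc u)
    = card (lev (Suc k)) + card (lev (Suc (Suc k))) + (\<Sum>u\<in>lev (Suc (Suc k)). inc u)"
proof -
  have "(\<Sum>u\<in>lev (Suc k). inc u) = (\<Sum>u\<in>lev (Suc k). 1 + card (chd u) + (\<Sum>c\<in>chd u. inc c))"
    using lev_Suc_subset[of k] by (intro sum.cong inc_eq) auto
  moreover have "card (lev (Suc (Suc k))) = (\<Sum>u\<in>lev (Suc k). card (chd u))"
    using sum_lev_Suc[of "\<lambda>_. 1::nat" "Suc k"] by simp
  ultimately show ?thesis
    by (simp add: sum.distrib sum_lev_Suc[of inc "Suc k"])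
qed

text \<open>Iterating \<open>sum_inc_lev_step\<close> downwards counts level \<open>k\<close> once
  and every deeper level twice, once as children and once for itself.\<close>

lemma sum_inc_lev:
  assumes "1 \<le> k"
  shows "(\<Sum>u\<in>lev k. inc u) = 2 * real (card (deep k)) - card (lev k)"
proof -
  have "(\<Sum>u\<in>lev (Suc k). inc u) = 2 * real (card (deep (Suc k))) - card (lev (Suc k))" for k
  proof (induction "Max (dep ` V) - k" arbitrary: k rule: less_induct)
    case less
    show ?case
    proof (cases "k < Max (dep ` V)")
      case True
      then show ?thesis
        using less[of "Suc k"] card_deep[of "Suc k"] by (simp add: sum_inc_lev_step[of k])
    next
      case False
      then have "deep (Suc k) = {}"
        using Max_ge[of "dep ` V"] finite_V by (fastforce simp: deep_def)
      then show ?thesis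
        using deep_eq[of "Suc k"] by simp
    qed
  qed
  from this[of "k - 1"] show ?thesis using assms by simp
qed

text \<open>As the increments are nonnegative, each is at most their sum.\<close>

lemma sum_inc_sq_lev_le: "1 \<le> k \<Longrightarrow> (\<Sum>u\<in>lev k. (inc u)\<^sup>2) \<le> (\<Sum>u\<in>lev k. inc u)\<^sup>2"
proof -
  assume "1 \<le> k"
  then have nonneg: "0 \<le> inc u" if "u \<in> lev k" for u
    using inc_ge_1[of u] that lev_Suc_subset[of "k - 1"] by (fastforce intro: order_trans[of 0 1])
  have "(\<Sum>u\<in>lev k. (inc u)\<^sup>2) \<le> (\<Sum>u\<in>lev k. inc u * (\<Sum>v\<in>lev k. inc v))"
    unfolding power2_eq_square
    by (intro sum_mono mult_left_mono nonneg member_le_sum) auto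
  also have "\<dots> = (\<Sum>u\<in>lev k. inc u)\<^sup>2"
    by (simp add: power2_eq_square sum_distrib_right)
  finally show ?thesis .
qed

text \<open>Chains \<open>sum_inc_sq_lev_le\<close> with
  \<open>2 * N - m \<le> 2 * (n - k) - 1\<close>, which uses \<open>m \<ge> 1\<close> and
  \<open>N \<le> n - k\<close> on a nonempty level. Equality in the second estimate forces both of
  these to be equalities.\<close>

lemma sum_inc_sq_lev_bound:
  assumes k: "1 \<le> k" "k < card V"
  shows "(\<Sum>u\<in>lev k. (inc u)\<^sup>2) \<le> (2 * (real (card V) - k) - 1)\<^sup>2"
    and "(\<Sum>u\<in>lev k. (inc u)\<^sup>2) = (2 * (real (card V) - k) - 1)\<^sup>2 \<longleftrightarrow> card (lev k) = 1 \<and> card (deep k) + k = card V"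
proof -
  let ?B = "2 * (real (card V) - k) - 1"
  \<comment> \<open>A positive base makes the bound strict on an empty level and allows passing from
    equal squares to equal bases.\<close>
  have B: "1 \<le> ?B"
    using of_nat_mono[of "k + 1" "card V", where 'a = real] k by simp
  consider "lev k = {}" | "lev k \<noteq> {}" by blast
  then have "(\<Sum>u\<in>lev k. (inc u)\<^sup>2) \<le> ?B\<^sup>2 \<and>
    ((\<Sum>u\<in>lev k. (inc u)\<^sup>2) = ?B\<^sup>2 \<longleftrightarrow> card (lev k) = 1 \<and> card (deep k) + k = card V)"
  proof cases
    case 2
    let ?S = "\<Sum>u\<in>lev k. inc u"
    have S: "?S = 2 * real (card (deep k)) - card (lev k)"
      using k by (intro sum_inc_lev)
    have lev1: "1 \<le> card (lev k)"
      using 2 by (simp add: Suc_le_eq card_gt_0_iff)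
    have deep1: "card (lev k) \<le> card (deep k)"
      using card_deep[of k] by simp
    have deep2: "card (deep k) + k \<le> card V"
      by (rule card_deep_le[OF 2])
    have "1 \<le> real (card (lev k))" "real (card (lev k)) \<le> real (card (deep k))"
      "real (card (deep k)) + real k \<le> real (card V)"
      using lev1 deep1 deep2 by linarith+
    then have S0: "0 \<le> ?S" and SB: "?S \<le> ?B"
      unfolding S by (simp_all add: algebra_simps)
    have le: "(\<Sum>u\<in>lev k. (inc u)\<^sup>2) \<le> ?S\<^sup>2"
      using k by (intro sum_inc_sq_lev_le)
    have le2: "?S\<^sup>2 \<le> ?B\<^sup>2"
      using S0 SB by (rule power_mono[rotated])
    have "card (lev k) = 1 \<and> card (deep k) + k = card V" if "(\<Sum>u\<in>lev k. (inc u)\<^sup>2) = ?B\<^sup>2"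
    proof -
      have "?S\<^sup>2 = ?B\<^sup>2"
        using le le2 that by linarith
      then have "?S = ?B"
        using S0 B by (simp add: power2_eq_iff_nonneg)
      then have "real (card (lev k)) \<le> 1" "real (card V) \<le> real (card (deep k) + k)"
        using of_nat_mono[OF lev1, where 'a = real] of_nat_mono[OF deep2, where 'a = real]
        unfolding S by simp_all
      then have "card (lev k) \<le> 1" "card V \<le> card (deep k) + k"
        by simp_all
      then show ?thesis
        using lev1 deep2 by simp
    qed
    moreover have "(\<Sum>u\<in>lev k. (inc u)\<^sup>2) = ?B\<^sup>2" if c: "card (lev k) = 1" "card (deep k) + k = card V"
    proof -
      obtain u where u: "lev k = {u}"
        using c(1) by (rule card_1_singletonE)
      have "?S = ?B"
        unfolding S using c(1) by (simp add: c(2)[symmetric])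
      then show ?thesis by (simp add: u)
    qed
    ultimately show ?thesis
      using le le2 by auto
  qed (use B in auto)
  then show "(\<Sum>u\<in>lev k. (inc u)\<^sup>2) \<le> ?B\<^sup>2"
    and "(\<Sum>u\<in>lev k. (inc u)\<^sup>2) = ?B\<^sup>2 \<longleftrightarrow> card (lev k) = 1 \<and> card (deep k) + k = card V"
    by auto
qed

section \<open>Summation over the levels of a tree of depth at most \<open>d\<close>\<close>

context
  fixes d :: nat
  assumes d: "1 \<le> d" "d < card V"
    and dep_le: "\<And>u. u \<in> V \<Longrightarrow> dep u \<le> d"
begin

lemma sum_nonroot_lev: "(\<Sum>u\<in>V - {r}. f u) = (\<Sum>k = 1..<d. \<Sum>u\<in>lev k. f u) + (\<Sum>u\<in>lev d. f u)"
  for f :: "'a \<Rightarrow> real"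
proof -
  have "(\<Sum>u\<in>V - {r}. f u) = (\<Sum>k\<in>{1..d}. \<Sum>u\<in>{u \<in> V - {r}. dep u = k}. f u)"
    using finite_V dep_le dep_eq_0_iff
    by (intro sum.group[symmetric]) (auto simp: Suc_le_eq intro: Nat.gr0I)
  also have "\<dots> = (\<Sum>k\<in>{1..d}. \<Sum>u\<in>lev k. f u)"
    by (intro sum.cong refl) (auto simp: lev_def dep_root)
  also have "{1..d} = insert d {1..<d}"
    using d by auto
  finally show ?thesis by simp
qed

lemma lev_bottom: "lev d = deep d"
  using dep_le by (auto simp: lev_def deep_def intro: antisym)

text \<open>Vertices on the lowest possible level have no children, so \<open>inc_eq\<close> gives
  increment 1. This level therefore enters linearly and is kept apart from the others.\<close>

lemma sum_inc_sq_bottom: "(\<Sum>u\<in>lev d. (inc u)\<^sup>2) = card (lev d)"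
proof -
  have "inc u = 1" if u: "u \<in> lev d" for u
  proof -
    have "chd u = {}"
      using u dep_le dep_par by (fastforce simp: chd_def lev_def)
    moreover have "u \<in> V - {r}"
      using u lev_Suc_subset[of "d - 1"] d by auto
    ultimately show ?thesis
      by (simp add: inc_eq)
  qed
  then show ?thesis by simp
qed

lemma card_bottom_le: "card (lev d) \<le> card V - d"
  using card_deep_le[of d] by (cases "lev d = {}") (auto simp: lev_bottom[symmetric])

lemma sum_inc_sq_le:
  "(\<Sum>u\<in>V - {r}. (inc u)\<^sup>2) \<le> (\<Sum>k = 1..<d. (2 * (real (card V) - k) - 1)\<^sup>2) + (real (card V) - d)"
  unfolding sum_nonroot_lev sum_inc_sq_bottom
  using d card_bottom_le by (intro add_mono sum_mono sum_inc_sq_lev_bound(1)) auto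

text \<open>Only the levels strictly between 0 and \<open>d\<close> appear: level 0 is the root, and
  once the others are singletons, level \<open>d\<close> holds the remaining \<open>n - d\<close>
  vertices.\<close>

lemma sum_inc_sq_eq_iff:
  "(\<Sum>u\<in>V - {r}. (inc u)\<^sup>2) = (\<Sum>k = 1..<d. (2 * (real (card V) - k) - 1)\<^sup>2) + (real (card V) - d)
    \<longleftrightarrow> (\<forall>k. 1 \<le> k \<and> k < d \<longrightarrow> card (lev k) = 1)" (is "?l = ?r \<longleftrightarrow> ?P")
proof
  assume P: ?P
  have deep: "card (deep k) + k = card V" if "k \<le> d" for k
    using that P by (intro card_deep_eq) auto
  have "(\<Sum>u\<in>lev k. (inc u)\<^sup>2) = (2 * (real (card V) - k) - 1)\<^sup>2" if "k \<in> {1..<d}" for k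
    using that d P deep by (subst sum_inc_sq_lev_bound(2)) auto
  moreover have "real (card (lev d)) = real (card V) - d"
    using deep[of d] d by (simp add: lev_bottom)
  ultimately show "?l = ?r"
    unfolding sum_nonroot_lev sum_inc_sq_bottom by simp
next
  assume eq: "?l = ?r"
  show ?P
  proof (intro allI impI)
    fix k assume k: "1 \<le> k \<and> k < d"
    let ?B = "\<lambda>k. (2 * (real (card V) - real k) - 1)\<^sup>2"
    have le: "(\<Sum>u\<in>lev j. (inc u)\<^sup>2) \<le> ?B j" if "j \<in> {1..<d}" for j
      using that d by (intro sum_inc_sq_lev_bound(1)) auto
    \<comment> \<open>Level \<open>d\<close> contributes at most \<open>n - d\<close>, so the levels
      above must reach the sum of their bounds, hence each its own.\<close>
    have "(\<Sum>j = 1..<d. \<Sum>u\<in>lev j. (inc u)\<^sup>2) \<ge> (\<Sum>j = 1..<d. ?B j)"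
      using eq card_bottom_le d unfolding sum_nonroot_lev sum_inc_sq_bottom by linarith
    then have "(\<Sum>j = 1..<d. \<Sum>u\<in>lev j. (inc u)\<^sup>2) = (\<Sum>j = 1..<d. ?B j)"
      by (rule antisym[rotated]) (rule sum_mono, rule le)
    then have "(\<Sum>u\<in>lev k. (inc u)\<^sup>2) = ?B k"
      by (rule sum_mono_inv) (use le k in auto)
    then show "card (lev k) = 1"
      using k d by (subst (asm) sum_inc_sq_lev_bound(2)) auto
  qed
qed

end

end

text \<open>The sum of all squared increments for the broom rooted at the far end of its
  handle.\<close>

definition max_energy :: "nat \<Rightarrow> nat \<Rightarrow> real" where
  "max_energy n d = (\<Sum>k = 1..<d. (2 * (real n - real k) - 1)\<^sup>2) + (real n - d)"

lemma max_energy_eq: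
  assumes "1 \<le> d" "2 \<le> n"
  shows "max_energy n d / (2 * (real n - 1)) = 2 * (real d - 1) * real n
      + (2 * real d ^ 3 - 6 * real d ^ 2 + 4 * real d) / (3 * (real n - 1))
      - 2 * real d ^ 2 + 2 * real d + 1 / 2"
proof -
  define E where "E = (\<Sum>k = 1..<d. (2 * (real n - real k) - 1)\<^sup>2)"
  \<comment> \<open>Expands the square in powers of \<open>k\<close> and inserts the closed forms of
    the sums of \<open>k\<close> and of \<open>k\<close> squared; the factor 6 clears their
    denominators.\<close>
  have "6 * E
    = 6 * (real d - 1) * (2 * real n - 1)\<^sup>2 - 12 * (2 * real n - 1) * (real d * (real d - 1))
      + 4 * (real d * (real d - 1) * (2 * real d - 1))"
    using assms(1) unfolding E_def
    by (induction d rule: dec_induct) (simp_all add: power2_eq_square algebra_simps)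
  then have E: "E = (real d - 1) * (2 * real n - 1)\<^sup>2 - 2 * (2 * real n - 1) * (real d * (real d - 1))
      + 2 / 3 * (real d * (real d - 1) * (2 * real d - 1))"
    by (simp add: field_simps)
  have "real n - 1 \<noteq> 0"
    using assms(2) by simp
  then show ?thesis
    unfolding max_energy_def E_def[symmetric] E
    by (simp add: divide_simps) (simp add: power2_eq_square power3_eq_cube algebra_simps)
qed

lemma ennreal_one_plus_sum:
  assumes "0 \<le> c" "\<And>x. 0 \<le> g x"
  shows "1 + (\<Sum>x\<in>A. ennreal c * ennreal (g x)) = ennreal (1 + (\<Sum>x\<in>A. c * g x))"
  using assms by (simp add: ennreal_plus sum_nonneg flip: ennreal_mult sum_ennreal)

section \<open>Finite hitting times of the root and the meeting time there\<close>

context rooted_tree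
begin

context
  assumes nontrivial: "2 \<le> card V"
begin

text \<open>Any non-root vertex has an ancestor on level 1, which is a child of the root; the other
  vertices have their parents.\<close>

lemma neighbors_nonempty:
  assumes "u \<in> V"
  shows "neighbors G u \<noteq> {}"
proof (cases "u = r")
  case True
  have "card (V - {r}) \<noteq> 0"
    using nontrivial root_in_V finite_V by (simp add: card_Diff_subset)
  then obtain v where v: "v \<in> V - {r}"
    by (metis card.empty ex_in_conv)
  then have "1 \<le> dep v" "v \<in> lev (dep v)"
    using dep_par by (auto simp: lev_def)
  then have "lev 1 \<noteq> {}"
    using lev_nonempty by blast
  then obtain x where "x \<in> lev (Suc 0)"
    by auto
  then have "x \<in> chd r"
    using par_lev[of x 0] lev_Suc_subset[of 0] by (auto simp: lev_0 chd_def)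
  then show ?thesis
    using True neighbors_root by auto
next
  case False
  then show ?thesis
    using assms neighbors_eq by auto
qed

lemmas tree_hitting_time_step = hitting_time_step[OF pair_graph neighbors_nonempty]
lemmas tree_hitting_time_le = hitting_time_le_supersolution[OF pair_graph neighbors_nonempty]

lemma hitting_time_finite:
  assumes "u \<in> V"
  shows "hitting_time G u r < \<top>"
proof -
  \<comment> \<open>The increments of \<open>g\<close> decay by the factor \<open>2n\<close> per level, so that the step to the parent
    outweighs the steps to all children.\<close>
  define n where "n = card V"
  define K where "K = Max (dep ` V)"
  define g :: "'a \<Rightarrow> real" where "g u = (\<Sum>i<dep u. (2 * real n) ^ (K - i))" for u
  have g_nonneg: "0 \<le> g u" for u
    unfolding g_def by (intro sum_nonneg) simp
  have "hitting_time G u r \<le> ennreal (g u)"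
  proof (rule tree_hitting_time_le[OF _ assms])
    fix u assume u: "u \<in> V" "u \<noteq> r"
    let ?N = "neighbors G u"
    let ?q = "(2 * real n) ^ (K - dep u)"
    have N: "card ?N = Suc (card (chd u))"
      using u by (intro card_neighbors) auto
    have g_par: "g (par u) = g u - 2 * real n * ?q"
    proof -
      have "dep u \<le> K"
        unfolding K_def using u finite_V by (intro Max_ge) auto
      then have "K - dep (par u) = Suc (K - dep u)"
        using dep_par[of u] u by simp
      then show ?thesis
        using dep_par[of u] u by (simp add: g_def)
    qed
    have g_chd: "g c = g u + ?q" if "c \<in> chd u" for c
      using that dep_par[of c] by (auto simp: g_def chd_def)
    have "(\<Sum>x\<in>?N. g x) = (g u - 2 * real n * ?q) + card (chd u) * (g u + ?q)"
      using u by (simp add: neighbors_eq par_notin_chd g_par g_chd)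
    then have sum_N: "(\<Sum>x\<in>?N. g x) = card ?N * g u - (2 * real n - card (chd u)) * ?q"
      by (simp add: N algebra_simps)
    have "?N \<subseteq> V"
      by (rule neighbors_subset[OF pair_graph neighbors_nonempty])
    then have "card ?N \<le> n"
      unfolding n_def using finite_V by (rule card_mono[rotated])
    then have n: "real (card ?N) \<le> real n" "real (card (chd u)) \<le> real n" "1 \<le> 2 * real n"
      using N nontrivial by (auto simp: n_def)
    \<comment> \<open>Both the degree and the number of children are at most \<open>n\<close>, so
      \<open>2 * n\<close> minus the latter still dominates the degree; the power \<open>?q\<close>
      is at least 1.\<close>
    have "real (card ?N) * 1 \<le> (2 * real n - card (chd u)) * ?q"
      by (rule mult_mono) (use n one_le_power[OF n(3)] in auto)
    then have "card ?N + (\<Sum>x\<in>?N. g x) \<le> card ?N * g u"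
      by (simp add: sum_N)
    then have "1 + (\<Sum>x\<in>?N. 1 / card ?N * g x) \<le> g u"
      by (simp add: N field_simps flip: sum_divide_distrib)
    then have "ennreal (1 + (\<Sum>x\<in>?N. 1 / card ?N * g x)) \<le> ennreal (g u)"
      by (rule ennreal_leI)
    also have "ennreal (1 + (\<Sum>x\<in>?N. 1 / card ?N * g x)) = 1 + (\<Sum>x\<in>?N. ennreal (1 / card ?N) * ennreal (g x))"
      by (intro ennreal_one_plus_sum[symmetric] g_nonneg) simp
    finally show "1 + (\<Sum>x\<in>?N. ennreal (1 / card ?N) * ennreal (g x)) \<le> ennreal (g u)" .
  qed
  then show ?thesis
    using ennreal_less_top by (rule le_less_trans)
qed

definition mean_hit :: "'a \<Rightarrow> real" where
  "mean_hit u = enn2real (hitting_time G u r)"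

lemma mean_hit_nonneg: "0 \<le> mean_hit u"
  by (simp add: mean_hit_def)

lemma hitting_time_eq: "u \<in> V \<Longrightarrow> hitting_time G u r = ennreal (mean_hit u)"
  using hitting_time_finite by (simp add: mean_hit_def)

text \<open>Finiteness allows the first-step equation to be carried from \<open>ennreal\<close> to
  the reals.\<close>

lemma tree_potential_mean_hit: "tree_potential G r par dep mean_hit"
proof unfold_locales
  show "mean_hit r = 0"
    by (simp add: mean_hit_def hitting_time_same)
  fix u assume u: "u \<in> V - {r}"
  let ?N = "neighbors G u"
  have N: "0 < card ?N"
    using u by (simp add: card_neighbors)
  have "ennreal (mean_hit u) = 1 + (\<Sum>x\<in>?N. ennreal (1 / card ?N) * hitting_time G x r)"
    using u tree_hitting_time_step[of u r] by (simp flip: hitting_time_eq)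
  also have "\<dots> = 1 + (\<Sum>x\<in>?N. ennreal (1 / card ?N) * ennreal (mean_hit x))"
    using neighbors_subset[OF pair_graph neighbors_nonempty, of u]
    by (intro arg_cong2[where f = "(+)"] sum.cong) (auto simp: hitting_time_eq)
  also have "\<dots> = ennreal (1 + (\<Sum>x\<in>?N. 1 / card ?N * mean_hit x))"
    by (intro ennreal_one_plus_sum mean_hit_nonneg) simp
  finally have "mean_hit u = 1 + (\<Sum>x\<in>?N. 1 / card ?N * mean_hit x)"
    by (subst (asm) ennreal_inj) (auto intro!: mean_hit_nonneg add_nonneg_nonneg sum_nonneg divide_nonneg_nonneg)
  then show "card ?N * mean_hit u = card ?N + (\<Sum>x\<in>?N. mean_hit x)"
    using N by (simp add: field_simps flip: sum_divide_distrib)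
qed

interpretation P: tree_potential G r par dep mean_hit
  by (rule tree_potential_mean_hit)

lemma meeting_time_at_root:
  "meeting_time_at G r = ennreal ((\<Sum>u\<in>V - {r}. (P.inc u)\<^sup>2) / (2 * (real (card V) - 1)))"
proof -
  have stationary: "stationary G v = card (neighbors G v) / (2 * (real (card V) - 1))" for v
    using nontrivial by (simp add: stationary_def card_edges of_nat_diff)
  have "meeting_time_at G r = (\<Sum>v\<in>V. ennreal (stationary G v * mean_hit v))"
    unfolding meeting_time_at_def
    by (intro sum.cong refl) (simp add: hitting_time_eq mean_hit_nonneg ennreal_mult'' del: times_divide_eq_left)
  also have "\<dots> = ennreal (\<Sum>v\<in>V. stationary G v * mean_hit v)"
    by (intro sum_ennreal mult_nonneg_nonneg mean_hit_nonneg) (simp add: stationary_def)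
  also have "(\<Sum>v\<in>V. stationary G v * mean_hit v)
    = (\<Sum>v\<in>V. card (neighbors G v) * mean_hit v) / (2 * (real (card V) - 1))"
    by (simp add: stationary sum_divide_distrib)
  finally show ?thesis
    by (simp add: P.sum_degree_mult_h)
qed

context
  fixes d :: nat
  assumes d: "1 \<le> d" "d < card V" and dep_le: "\<And>u. u \<in> V \<Longrightarrow> dep u \<le> d"
begin

lemma meeting_time_at_root_le:
  "meeting_time_at G r \<le> ennreal (max_energy (card V) d / (2 * (real (card V) - 1)))"
  unfolding meeting_time_at_root max_energy_def
  using P.sum_inc_sq_le[OF d dep_le] nontrivial by (intro ennreal_leI divide_right_mono) auto

lemma meeting_time_at_root_eq_iff:
  "meeting_time_at G r = ennreal (max_energy (card V) d / (2 * (real (card V) - 1)))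
    \<longleftrightarrow> (\<forall>k. 1 \<le> k \<and> k < d \<longrightarrow> card (lev k) = 1)"
proof -
  have pos: "0 < 2 * (real (card V) - 1)"
    using nontrivial by simp
  have "0 \<le> (\<Sum>u\<in>V - {r}. (P.inc u)\<^sup>2)" "0 \<le> max_energy (card V) d"
    using d by (auto simp: max_energy_def intro!: sum_nonneg add_nonneg_nonneg)
  then have "meeting_time_at G r = ennreal (max_energy (card V) d / (2 * (real (card V) - 1)))
    \<longleftrightarrow> (\<Sum>u\<in>V - {r}. (P.inc u)\<^sup>2) = max_energy (card V) d"
    unfolding meeting_time_at_root using pos by (subst ennreal_inj) auto
  also have "\<dots> \<longleftrightarrow> (\<forall>k. 1 \<le> k \<and> k < d \<longrightarrow> card (lev k) = 1)"
    unfolding max_energy_def by (rule P.sum_inc_sq_eq_iff[OF d dep_le])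
  finally show ?thesis .
qed

end

end

end

section \<open>Trees as rooted trees\<close>

text \<open>Connectedness is defined through the symmetric closure, which for a graph with symmetric
  arcs is the graph itself.\<close>

lemma mk_symmetric_pair_graph:
  assumes "pair_graph G"
  shows "mk_symmetric (with_proj G) = G"
proof -
  interpret pair_graph G by (rule assms)
  show ?thesis
    using arcs_symmetric by (auto simp: mk_symmetric_def intro!: pair_pre_digraph.equality)
qed

lemma connected_pair_graph_iff:
  assumes "pair_graph G"
  shows "Digraph_Component.connected (with_proj G)
    \<longleftrightarrow> pverts G \<noteq> {} \<and> (\<forall>u\<in>pverts G. \<forall>v\<in>pverts G. \<exists>p. pre_digraph.awalk (with_proj G) u p v)"
proof -
  interpret pair_graph G by (rule assms)
  show ?thesis
    by (auto simp: Digraph_Component.connected_def mk_symmetric_pair_graph assms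
        strongly_connected_def reachable_awalk)
qed

lemma (in wf_digraph) awalk_cost_one: "awalk_cost (\<lambda>_. 1) p = length p"
  by (induction p) auto

context rooted_tree
begin

lemma awalk_up:
  assumes "u \<in> V" "j \<le> dep u"
  shows "\<exists>p. pre_digraph.awalk (with_proj G) u p ((par ^^ j) u) \<and> length p = j"
    and "(par ^^ j) u \<in> V" "dep ((par ^^ j) u) = dep u - j"
proof -
  interpret pair_graph G by (rule pair_graph)
  have "(\<exists>p. awalk u p ((par ^^ j) u) \<and> length p = j) \<and> (par ^^ j) u \<in> V \<and> dep ((par ^^ j) u) = dep u - j"
    using assms(2)
  proof (induction j)
    case 0
    then show ?case using assms(1) by (auto simp: awalk_Nil_iff)
  next
    case (Suc j)
    let ?x = "(par ^^ j) u"
    obtain p where p: "awalk u p ?x" "length p = j"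
      using Suc by auto
    have x: "?x \<in> V - {r}"
      using Suc dep_root by (cases "?x = r") auto
    then have "awalk ?x [(?x, par ?x)] (par ?x)"
      using par_in_V by (auto simp: awalk_Cons_iff awalk_Nil_iff arc_iff)
    with p have "awalk u (p @ [(?x, par ?x)]) (par ?x)"
      by (auto intro: awalk_appendI)
    then show ?case
      using p(2) x par_in_V[OF x] dep_par[OF x] Suc by (intro conjI exI[of _ "p @ [(?x, par ?x)]"]) auto
  qed
  then show "\<exists>p. awalk u p ((par ^^ j) u) \<and> length p = j"
    and "(par ^^ j) u \<in> V" "dep ((par ^^ j) u) = dep u - j" by auto
qed

text \<open>Climb from \<open>u\<close> to the ancestor, then follow the climb from \<open>v\<close>
  backwards. This serves both connectedness and the diameter of the broom.\<close>

lemma awalk_via_common_ancestor: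
  assumes "u \<in> V" "v \<in> V" "i \<le> dep u" "j \<le> dep v" "(par ^^ i) u = (par ^^ j) v"
  shows "\<exists>p. pre_digraph.awalk (with_proj G) u p v \<and> length p = i + j"
proof -
  interpret pair_graph G by (rule pair_graph)
  obtain p q where p: "awalk u p ((par ^^ i) u)" "length p = i"
    and q: "awalk v q ((par ^^ i) u)" "length q = j"
    using awalk_up(1)[OF assms(1,3)] awalk_up(1)[OF assms(2,4)] assms(5) by auto
  have "awalk ((par ^^ i) u) (rev_path q) v"
    using q(1) by simp
  with p(1) have "awalk u (p @ rev_path q) v"
    by (rule awalk_appendI)
  moreover have "length (rev_path q) = length q" for q :: "('a \<times> 'a) list"
    by (induction q) auto
  ultimately show ?thesis
    using p(2) q(2) by (intro exI[of _ "p @ rev_path q"]) auto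
qed

lemma awalk_exists:
  assumes "u \<in> V" "v \<in> V"
  shows "\<exists>p. pre_digraph.awalk (with_proj G) u p v"
proof -
  have "(par ^^ dep u) u = r" if "u \<in> V" for u
    using awalk_up(2,3)[of u "dep u"] that dep_eq_0_iff by simp
  then show ?thesis
    using awalk_via_common_ancestor[of u v "dep u" "dep v"] assms by auto
qed

lemma is_tree: "is_tree G"
  unfolding is_tree_def connected_pair_graph_iff[OF pair_graph]
  using pair_graph awalk_exists no_long_cycle root_in_V by auto

text \<open>Every walk from \<open>u\<close> to the root has at least \<open>dep u\<close> arcs. A
  given diameter thus bounds the depth for every choice of root.\<close>

lemma dep_le_diameter:
  assumes "u \<in> V"
  shows "ereal (real (dep u)) \<le> graph_diameter G"
proof -
  interpret pair_graph G by (rule pair_graph)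
  have "ereal (dep u) \<le> \<mu> (\<lambda>_. 1) u r"
    unfolding \<mu>_def by (intro INF_greatest) (use awalk_dep_le[of u _ r] in \<open>auto simp: awalk_cost_one dep_root\<close>)
  also have "\<dots> \<le> graph_diameter G"
    unfolding graph_diameter_def using assms root_in_V by (intro SUP_upper2[of u] SUP_upper2[of r]) auto
  finally show ?thesis .
qed

text \<open>An arc outside the rooted tree would close up the tree path between its ends to a long cycle.\<close>

lemma parcs_eq_if_no_long_cycle:
  assumes H: "pair_graph H" and "pverts H = V" and sub: "parcs G \<subseteq> parcs H"
    and no_cycle: "\<not> (\<exists>p. pre_digraph.cycle (with_proj H) p \<and> 3 \<le> length p)"
  shows "parcs H = parcs G"
proof (rule ccontr)
  interpret G: pair_graph G by (rule pair_graph)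
  interpret H: pair_graph H by (rule H)
  assume "parcs H \<noteq> parcs G"
  then obtain x y where xy: "(x, y) \<in> parcs H" "(x, y) \<notin> parcs G"
    using sub by auto
  then have V: "x \<in> V" "y \<in> V" and neq: "x \<noteq> y"
    using H.in_arcsD1 H.in_arcsD2 H.no_loops' assms(2) by auto
  obtain p where p: "G.apath x p y"
    using awalk_exists[OF V] G.apath_awalk_to_apath by blast
  then have walk: "H.awalk x p y"
    using sub V assms(2) by (auto simp: G.apath_def G.awalk_def H.awalk_def)
  have "p \<noteq> []"
    using p neq by (auto simp: G.apath_Nil_iff)
  \<comment> \<open>A path with a single arc would be the missing arc \<open>(x, y)\<close>
    itself.\<close>
  moreover have "length p \<noteq> 1"
    using p xy(2) by (auto simp: length_Suc_conv G.apath_Cons_iff G.apath_Nil_iff)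
  ultimately have len: "3 \<le> length (p @ [(y, x)])"
    by (cases p; cases "tl p") auto
  have closed: "H.awalk x (p @ [(y, x)]) x"
    using walk xy V assms(2) H.arcs_symmetric by (intro H.awalk_appendI[OF walk]) (auto simp: H.awalk_Cons_iff H.awalk_Nil_iff)
  have "hd (pawalk_verts x p) = x" "last (pawalk_verts x p) = y" "distinct (pawalk_verts x p)"
    using p by (auto simp: G.apath_def)
  moreover have "pawalk_verts x (p @ [(y, x)]) = pawalk_verts x p @ [x]"
    using H.awalk_verts_append[OF closed] walk by auto
  moreover have "pawalk_verts x p \<noteq> []"
    by (cases p) auto
  ultimately have "distinct (tl (pawalk_verts x (p @ [(y, x)])))"
    by (cases "pawalk_verts x p") auto
  then have "H.cycle (p @ [(y, x)])"
    using closed by (auto simp: H.cycle_def)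
  then show False
    using no_cycle len by blast
qed

end

text \<open>Depth is the distance to \<open>w\<close>, and a parent is a neighbor one step closer,
  found as the second vertex of a shortest walk. The parent arcs form a spanning rooted tree
  \<open>S\<close>, which exhausts \<open>T\<close> by
  \<open>parcs_eq_if_no_long_cycle\<close>.\<close>

lemma tree_rooted_at:
  assumes T: "is_tree T" and w: "w \<in> pverts T"
  obtains par dep where "rooted_tree T w par dep"
proof -
  have graph: "pair_graph T"
    using T by (simp add: is_tree_def)
  interpret pair_graph T by (rule graph)
  have walks: "\<exists>p. awalk u p w" if "u \<in> pverts T" for u
    using T w that unfolding is_tree_def connected_pair_graph_iff[OF graph] by blast
  define dep where "dep u = (LEAST k. \<exists>p. awalk u p w \<and> length p = k)" for u
  have dep_le: "dep u \<le> length p" if "awalk u p w" for u p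
    unfolding dep_def by (rule Least_le) (use that in blast)
  have dep_walk: "\<exists>p. awalk u p w \<and> length p = dep u" if "u \<in> pverts T" for u
    unfolding dep_def by (rule LeastI_ex) (use walks[OF that] in blast)
  have step: "\<exists>v. (u, v) \<in> parcs T \<and> dep u = Suc (dep v)" if u: "u \<in> pverts T - {w}" for u
  proof -
    obtain p where p: "awalk u p w" "length p = dep u"
      using dep_walk[of u] u by auto
    then obtain v q where q: "p = (u, v) # q" "(u, v) \<in> parcs T" "awalk v q w"
      using u by (cases p) (auto simp: awalk_Nil_iff awalk_Cons_iff)
    obtain q' where q': "awalk v q' w" "length q' = dep v"
      using dep_walk[of v] in_arcsD2[OF q(2)] by blast
    have "awalk u ((u, v) # q') w"
      using q q' by (simp add: awalk_Cons_iff)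
    then have "dep u \<le> Suc (dep v)"
      using dep_le[of u "(u, v) # q'"] q' by simp
    moreover have "Suc (dep v) \<le> dep u"
      using dep_le[OF q(3)] p q by simp
    ultimately have "dep u = Suc (dep v)" by (rule antisym)
    with q(2) show ?thesis by blast
  qed
  define par where "par u = (SOME v. (u, v) \<in> parcs T \<and> dep u = Suc (dep v))" for u
  have par: "(u, par u) \<in> parcs T" "dep u = Suc (dep (par u))" if "u \<in> pverts T - {w}" for u
    using someI_ex[OF step[OF that]] unfolding par_def by blast+
  define S where "S = \<lparr>pverts = pverts T, parcs = (\<lambda>u. (u, par u)) ` (pverts T - {w})
    \<union> (\<lambda>u. (par u, u)) ` (pverts T - {w})\<rparr>"
  have "dep w = 0"
    using dep_le[of w "[]"] w by (simp add: awalk_Nil_iff)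
  have S: "rooted_tree S w par dep"
  proof
    show "par u \<in> pverts S" "dep u = Suc (dep (par u))" if "u \<in> pverts S - {w}" for u
      using that par[of u] in_arcsD2[of u "par u"] by (simp_all add: S_def)
  qed (use w pair_finite_verts \<open>dep w = 0\<close> in \<open>simp_all add: S_def\<close>)
  have "parcs S \<subseteq> parcs T"
    using par(1) arcs_symmetric by (auto simp: S_def)
  then have "parcs T = parcs S"
    using rooted_tree.parcs_eq_if_no_long_cycle[OF S graph] T unfolding is_tree_def by (simp add: S_def)
  then have "S = T"
    by (intro pair_pre_digraph.equality) (simp_all add: S_def)
  with S show ?thesis
    by (intro that) simp
qed

text \<open>The root and the parent map determine all arcs, so a bijection respecting both carries
  arcs onto arcs.\<close>

lemma rooted_tree_iso:
  assumes G: "rooted_tree G r par dep" and H: "rooted_tree H r' par' dep'"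
    and f: "bij_betw f (pverts G) (pverts H)" "f r = r'"
    and f_par: "\<And>u. u \<in> pverts G - {r} \<Longrightarrow> f (par u) = par' (f u)"
  shows "digraph_iso (with_proj G) (with_proj H)"
proof -
  interpret G: rooted_tree G r par dep by (rule G)
  interpret H: rooted_tree H r' par' dep' by (rule H)
  interpret G': pair_graph G by (rule G.pair_graph)
  define hom where "hom = \<lparr>iso_verts = f, iso_arcs = map_prod f f, iso_head = snd, iso_tail = fst\<rparr>"
  have inj: "inj_on f (pverts G)" and img: "f ` pverts G = pverts H"
    using f by (auto simp: bij_betw_def)
  have "inj_on (map_prod f f) (parcs G)"
    by (rule inj_on_subset[OF map_prod_inj_on[OF inj inj]]) (auto dest: G'.in_arcsD1 G'.in_arcsD2)
  then have "pre_digraph.digraph_isomorphism (with_proj G) hom"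
    using inj by (auto simp: pre_digraph.digraph_isomorphism_def hom_def intro: G'.wf_digraph_axioms)
  moreover have "with_proj H = app_iso hom (with_proj G)"
  proof -
    have "f ` (pverts G - {r}) = pverts H - {r'}"
      using inj_on_image_set_diff[OF inj, of "pverts G" "{r}"] G.root_in_V f(2) img by auto
    moreover have "map_prod f f ` parcs G
      = (\<lambda>u. (u, par' u)) ` f ` (pverts G - {r}) \<union> (\<lambda>u. (par' u, u)) ` f ` (pverts G - {r})"
      unfolding G.parcs_eq image_Un image_image by (intro arg_cong2[where f = "(\<union>)"] image_cong) (auto simp: f_par)
    ultimately have "map_prod f f ` parcs G = parcs H"
      by (simp add: H.parcs_eq)
    then show ?thesis
      using img by (simp add: with_proj_def app_iso_def hom_def)
  qed
  ultimately show ?thesis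
    unfolding digraph_iso_def by blast
qed

section \<open>Brooms\<close>

text \<open>The root is \<open>Handle d\<close>, hence parents have larger handle index and, in
  \<open>broom_dep\<close>, the bristles lie on level \<open>d\<close>.\<close>

fun broom_par :: "broom_vertex \<Rightarrow> broom_vertex" where
  "broom_par (Handle i) = Handle (Suc i)"
| "broom_par (Bristle j) = Handle 1"

fun broom_dep :: "nat \<Rightarrow> broom_vertex \<Rightarrow> nat" where
  "broom_dep d (Handle i) = d - i"
| "broom_dep d (Bristle j) = d"

lemma pverts_broom: "pverts (broom n d) = Handle ` {1..d} \<union> Bristle ` {1..n - d}"
  by (simp add: broom_def)

lemma parcs_broom: "parcs (broom n d) = broom_half_arcs n d \<union> (broom_half_arcs n d)\<inverse>"
  by (simp add: broom_def)

lemma card_broom: "d \<le> n \<Longrightarrow> card (pverts (broom n d)) = n"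
  unfolding pverts_broom by (subst card_Un_disjoint) (auto simp: card_image inj_on_def)

lemma rooted_tree_broom:
  assumes "1 \<le> d"
  shows "rooted_tree (broom n d) (Handle d) broom_par (broom_dep d)"
proof
  let ?V = "pverts (broom n d) - {Handle d}"
  have V: "?V = Handle ` {1..<d} \<union> Bristle ` {1..n - d}"
    by (auto simp: pverts_broom)
  show "broom_par u \<in> pverts (broom n d)" "broom_dep d u = Suc (broom_dep d (broom_par u))" if "u \<in> ?V" for u
    using that assms unfolding V by (auto simp: pverts_broom)
  have "broom_half_arcs n d = (\<lambda>u. (u, broom_par u)) ` Handle ` {1..<d} \<union> (\<lambda>u. (broom_par u, u)) ` Bristle ` {1..n - d}"
    by (auto simp: broom_half_arcs_def image_iff)
  then show "parcs (broom n d) = (\<lambda>u. (u, broom_par u)) ` ?V \<union> (\<lambda>u. (broom_par u, u)) ` ?V"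
    unfolding parcs_broom V by (auto simp: image_Un image_iff)
qed (use assms in \<open>auto simp: pverts_broom\<close>)

lemma broom_par_funpow_Handle: "(broom_par ^^ j) (Handle i) = Handle (i + j)"
  by (induction j) auto

lemma broom_par_funpow_Bristle: "1 \<le> j \<Longrightarrow> (broom_par ^^ j) (Bristle b) = Handle j"
  by (induction j rule: dec_induct) auto

text \<open>A bristle has depth \<open>d\<close>, which gives the lower bound; for the upper bound,
  any two vertices are joined through a common ancestor by at most \<open>d\<close> arcs.\<close>

lemma graph_diameter_broom:
  assumes "2 \<le> d" "d < n"
  shows "graph_diameter (broom n d) = ereal (real d)"
proof (rule antisym)
  interpret B: rooted_tree "broom n d" "Handle d" broom_par "broom_dep d"
    using assms by (intro rooted_tree_broom) auto
  interpret pair_graph "broom n d" by (rule B.pair_graph)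
  have "Bristle 1 \<in> pverts (broom n d)"
    using assms by (auto simp: pverts_broom)
  from B.dep_le_diameter[OF this] show "ereal d \<le> graph_diameter (broom n d)"
    by simp
  \<comment> \<open>The witnesses count the climbs to the lowest common ancestor. For two handle
    vertices one of the truncated differences is 0; a bristle reaches \<open>Handle a\<close> in
    \<open>a\<close> steps; for two bristles one step each suffices, and
    \<open>2 \<le> d\<close>.\<close>
  have "\<exists>i j. i \<le> broom_dep d u \<and> j \<le> broom_dep d v \<and> (broom_par ^^ i) u = (broom_par ^^ j) v \<and> i + j \<le> d"
    if u: "u \<in> pverts (broom n d)" and v: "v \<in> pverts (broom n d)" for u v
  proof (cases u; cases v)
    fix a b assume [simp]: "u = Handle a" "v = Handle b"
    show ?thesis
      using u v by (intro exI[of _ "b - a"] exI[of _ "a - b"]) (auto simp: broom_par_funpow_Handle pverts_broom)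
  next
    fix a b assume [simp]: "u = Handle a" "v = Bristle b"
    show ?thesis
      using u v by (intro exI[of _ 0] exI[of _ a]) (auto simp: broom_par_funpow_Bristle pverts_broom)
  next
    fix a b assume [simp]: "u = Bristle a" "v = Handle b"
    show ?thesis
      using u v by (intro exI[of _ b] exI[of _ 0]) (auto simp: broom_par_funpow_Bristle pverts_broom)
  next
    fix a b assume [simp]: "u = Bristle a" "v = Bristle b"
    show ?thesis
      using assms by (intro exI[of _ 1]) auto
  qed
  then have walk: "\<exists>p. awalk u p v \<and> length p \<le> d" if "u \<in> pverts (broom n d)" "v \<in> pverts (broom n d)" for u v
    using B.awalk_via_common_ancestor[of u v] that by metis
  have "\<mu> (\<lambda>_. 1) u v \<le> ereal d" if uv: "u \<in> pverts (broom n d)" "v \<in> pverts (broom n d)" for u v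
  proof -
    obtain p where p: "awalk u p v" "length p \<le> d"
      using walk[OF uv] by blast
    have "\<mu> (\<lambda>_. 1) u v \<le> ereal (length p)"
      using min_cost_le_walk_cost[OF p(1), of "\<lambda>_. 1"] by (simp add: awalk_cost_one)
    also have "\<dots> \<le> ereal d"
      using p(2) by simp
    finally show ?thesis .
  qed
  then show "graph_diameter (broom n d) \<le> ereal d"
    unfolding graph_diameter_def by (intro SUP_least)
qed

context rooted_tree
begin

text \<open>The levels above \<open>d\<close> are single vertices and form the handle, read from its
  far end; the \<open>n - d\<close> vertices on level \<open>d\<close> are matched with the bristles
  by an arbitrary bijection.\<close>

lemma iso_broom:
  assumes d: "1 \<le> d" "d < card V" and dep_le: "\<And>u. u \<in> V \<Longrightarrow> dep u \<le> d"
    and single: "\<And>k. 1 \<le> k \<Longrightarrow> k < d \<Longrightarrow> card (lev k) = 1"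
  shows "digraph_iso (with_proj G) (with_proj (broom (card V) d))"
proof -
  let ?B = "broom (card V) d"
  have "lev d = deep d"
    using dep_le by (auto simp: lev_def deep_def intro: antisym)
  then have "card (lev d) = card {1..card V - d}"
    using card_deep_eq[of d] single by simp
  then obtain b where b: "bij_betw b (lev d) {1..card V - d}"
    using finite_same_card_bij[OF finite_lev, of "{1..card V - d}" d] by auto
  define f where "f u = (if dep u < d then Handle (d - dep u) else Bristle (b u))" for u
  have lev_d: "u \<in> lev d" if "u \<in> V" "\<not> dep u < d" for u
    using that dep_le[of u] by (simp add: lev_def)
  have inj: "inj_on f V"
  proof (rule inj_onI)
    fix u v assume uv: "u \<in> V" "v \<in> V" "f u = f v"
    then consider "dep u < d" "dep u = dep v" | "u \<in> lev d" "v \<in> lev d" "b u = b v"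
      using lev_d by (auto simp: f_def split: if_splits)
    then show "u = v"
    proof cases
      case 1
      have "card (lev (dep u)) = 1"
        using single[of "dep u"] 1 lev_0 by (cases "dep u = 0") auto
      moreover have "u \<in> lev (dep u)" "v \<in> lev (dep u)"
        using uv 1 by (auto simp: lev_def)
      ultimately show ?thesis
        by (metis card_1_singletonE singletonD)
    next
      case 2
      then show ?thesis
        using b by (auto simp: bij_betw_def dest: inj_onD)
    qed
  qed
  have "f u \<in> pverts ?B" if "u \<in> V" for u
    using lev_d[OF that] bij_betwE[OF b] by (auto simp: f_def pverts_broom)
  \<comment> \<open>An injection between finite sets of equal size is onto.\<close>
  then have "f ` V = pverts ?B"
    using inj d by (intro card_subset_eq) (auto simp: card_image card_broom, simp add: pverts_broom)
  then have bij: "bij_betw f V (pverts ?B)"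
    using inj by (simp add: bij_betw_def)
  have f_par: "f (par u) = broom_par (f u)" if "u \<in> V - {r}" for u
    using dep_par[OF that] dep_le[of u] that by (auto simp: f_def Suc_diff_Suc)
  show ?thesis
    by (rule rooted_tree_iso[OF rooted_tree_axioms rooted_tree_broom bij _ f_par])
      (use d in \<open>auto simp: f_def dep_root\<close>)
qed

end

section \<open>Extremality and uniqueness of the broom\<close>

theorem theorem1p4:
  fixes n d :: nat
  assumes "3 \<le> d" and "d < n"
  shows "is_tree (broom n d) \<and> card (pverts (broom n d)) = n \<and> graph_diameter (broom n d) = ereal (real d)
    \<and> (\<forall>T :: 'a pair_pre_digraph.
          is_tree T \<and> card (pverts T) = n \<and> graph_diameter T = ereal (real d) \<longrightarrow>
          meeting_time T \<le> meeting_time (broom n d) \<and>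
          (meeting_time T = meeting_time (broom n d) \<longrightarrow>
             digraph_iso (with_proj T) (with_proj (broom n d))))
    \<and> meeting_time (broom n d) = meeting_time_at (broom n d) (Handle d)
    \<and> meeting_time_at (broom n d) (Handle d) =
        ennreal (2 * (real d - 1) * real n
          + (2 * real d ^ 3 - 6 * real d ^ 2 + 4 * real d) / (3 * (real n - 1))
          - 2 * real d ^ 2 + 2 * real d + 1 / 2)"
proof -
  let ?m = "ennreal (max_energy n d / (2 * (real n - 1)))"
  interpret B: rooted_tree "broom n d" "Handle d" broom_par "broom_dep d"
    using assms by (intro rooted_tree_broom) auto
  have card_B: "card (pverts (broom n d)) = n" and diam_B: "graph_diameter (broom n d) = ereal d"
    using assms by (auto intro: card_broom graph_diameter_broom)
  \<comment> \<open>Every vertex \<open>w\<close> is taken as a root in turn. The vertex type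
    \<open>'b\<close> is generic because the bound is applied to the broom as well as to the
    competing trees.\<close>
  have bound: "meeting_time_at T w \<le> ?m"
    and iso: "meeting_time_at T w = ?m \<Longrightarrow> digraph_iso (with_proj T) (with_proj (broom n d))"
    if T: "is_tree T" "card (pverts T) = n" "graph_diameter T = ereal d" and w: "w \<in> pverts T"
    for T :: "'b pair_pre_digraph" and w
  proof -
    obtain par dep where "rooted_tree T w par dep"
      using tree_rooted_at[OF T(1) w] .
    then interpret R: rooted_tree T w par dep .
    have dep_le: "dep u \<le> d" if "u \<in> pverts T" for u
      using R.dep_le_diameter[OF that] T(3) by simp
    have hyps: "2 \<le> card (pverts T)" "1 \<le> d" "d < card (pverts T)"
      using assms T(2) by auto
    show "meeting_time_at T w \<le> ?m"
      using R.meeting_time_at_root_le[OF hyps dep_le] T(2) by simp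
    show "digraph_iso (with_proj T) (with_proj (broom n d))" if "meeting_time_at T w = ?m"
      using R.iso_broom[OF hyps(2,3) dep_le] R.meeting_time_at_root_eq_iff[OF hyps dep_le] that T(2) by simp
  qed
  have max_le: "meeting_time T \<le> ?m"
    and max_eq: "meeting_time T = ?m \<Longrightarrow> digraph_iso (with_proj T) (with_proj (broom n d))"
    if T: "is_tree T" "card (pverts T) = n" "graph_diameter T = ereal d" for T :: "'b pair_pre_digraph"
  proof -
    have fin: "finite (pverts T)" "pverts T \<noteq> {}"
      using T(2) assms by (auto intro: card_ge_0_finite)
    then show "meeting_time T \<le> ?m"
      unfolding meeting_time_def using bound[OF T] by (subst Max_le_iff) auto
    have "meeting_time T \<in> meeting_time_at T ` pverts T"
      unfolding meeting_time_def using fin by (intro Max_in) auto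
    then show "digraph_iso (with_proj T) (with_proj (broom n d))" if "meeting_time T = ?m"
      using iso[OF T] that by auto
  qed
  \<comment> \<open>Seen from \<open>Handle d\<close>, the broom satisfies the equality condition of
    \<open>meeting_time_at_root_eq_iff\<close>.\<close>
  have "B.lev k = {Handle (d - k)}" if "1 \<le> k" "k < d" for k
    using that by (auto simp: B.lev_def pverts_broom)
  then have "card (B.lev k) = 1" if "1 \<le> k" "k < d" for k
    using that by simp
  moreover have "broom_dep d u \<le> d" for u
    by (cases u) auto
  ultimately have at_B: "meeting_time_at (broom n d) (Handle d) = ?m"
    using B.meeting_time_at_root_eq_iff[of d] assms unfolding card_B by simp
  have "meeting_time (broom n d) = ?m"
  \<comment> \<open>The general upper bound holds for the broom too, and the far end of the handle
    attains it.\<close>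
  proof (rule antisym)
    show "meeting_time (broom n d) \<le> ?m"
      by (rule max_le[OF B.is_tree card_B diam_B])
    show "?m \<le> meeting_time (broom n d)"
      unfolding meeting_time_def at_B[symmetric]
      using B.finite_V B.root_in_V by (intro Max_ge) auto
  qed
  moreover have "max_energy n d / (2 * (real n - 1)) = 2 * (real d - 1) * real n
      + (2 * real d ^ 3 - 6 * real d ^ 2 + 4 * real d) / (3 * (real n - 1))
      - 2 * real d ^ 2 + 2 * real d + 1 / 2"
    using assms by (intro max_energy_eq) auto
  moreover have "meeting_time T \<le> meeting_time (broom n d) \<and>
      (meeting_time T = meeting_time (broom n d) \<longrightarrow> digraph_iso (with_proj T) (with_proj (broom n d)))"
    if "is_tree T \<and> card (pverts T) = n \<and> graph_diameter T = ereal (real d)" for T :: "'a pair_pre_digraph"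
    unfolding \<open>meeting_time (broom n d) = ?m\<close> using that by (intro conjI impI max_le max_eq) auto
  ultimately show ?thesis
    using B.is_tree card_B diam_B at_B by simp
qed

end
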